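(* Let $X$ be a complete $RN$ module over $K$ with base $(\Omega,\mathcal F,P)$, let $C\in B(X)$ be injective, and let $\{V(s):s\ge0\}$ be a locally a.s. bounded $C$-semigroup on $X$ with generator $(A,D(A))$. For $s>0$ put $A_s=\frac{V(s)-C}{s}$. Then, for any $l>0$ and any $z\in D(A)$, $\bigvee_{s\in(0,l]}\|CA_sz\|$ belongs to $L^0_+(\mathcal F)$.
   Context: $(\Omega,\mathcal F,P)$ is a probability space, $K=\mathbb R$ or $\mathbb C$, $L^0(\mathcal F,K)$ is the algebra of equivalence classes (a.s. equality) of $K$-valued $\mathcal F$-measurable random variables, $\bar L^0(\mathcal F,R)$ the complete lattice of equivalence classes of extended real-valued random variables under a.s. order, and $L^0_+(\mathcal F)=\{\xi\in L^0(\mathcal F,R):\xi\ge 0\}$. $\bigvee$ and $\bigwedge$ denote supremum and infimum in $\bar L^0(\mathcal F,R)$. An $RN$ module over $K$ with base $(\Omega,\mathcal F,P)$ is an $L^0(\mathcal F,K)$-module $X$ with a map $\|\cdot\|:X\to L^0_+(\mathcal F)$ (the $L^0$-norm) such that $\|\xi x\|=|\xi|\|x\|$ for all $\xi\in L^0(\mathcal F,K)$, $x\in X$; $\|x+y\|\le\|x\|+\|y\|$; and $\|x\|=0$ implies $x=0$. It carries the $(\varepsilon,\lambda)$-topology, the metrizable linear topology with local base at $0$ given by $\{z: P(\|z\|<\varepsilon)>\lambda\}$, $\varepsilon>0$, $0<\lambda<1$; so $z_n\to z$ iff $\|z_n-z\|\to0$ in probability. Completeness, limits and continuity are in this topology.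 A linear operator $T:X\to X$ is a.s. bounded if there is $\eta\in L^0_+(\mathcal F)$ with $\|Tz\|\le\eta\|z\|$ for all $z\in X$; $B(X)$ is the set of these (equivalently, the continuous $L^0(\mathcal F,K)$-module homomorphisms on $X$), and $\|T\|=\bigwedge\{\eta\in L^0_+(\mathcal F):\|Tz\|\le\eta\|z\|\ \forall z\in X\}$. $R(C)$ is the range of $C$. $C$-semigroup on $X$ ($C\in B(X)$ injective): a family $\{V(s):s\ge0\}\subset B(X)$ such that $s\mapsto V(s)z$ is continuous from $[0,\infty)$ to $X$ for every $z\in X$; $V(0)=C$; and $CV(s+t)=V(s)V(t)$ for all $s,t\ge0$. It is locally a.s. bounded if $\bigvee_{s\in[0,l]}\|V(s)\|\in L^0_+(\mathcal F)$ for every $l>0$. Its generator $(A,D(A))$ is given by $D(A)=\{z\in X:\lim_{s\downarrow0}\frac{V(s)z-Cz}{s}\text{ exists and belongs to }R(C)\}$ and $Az=C^{-1}\lim_{s\downarrow0}\frac{V(s)z-Cz}{s}$ for $z\in D(A)$. *)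

theory Defs
  imports "HOL-Probability.Probability" "HOL-Algebra.Module" "HOL-Algebra.Complete_Lattice"
begin

section \<open>Equivalence classes of random variables\<close>

definition rv_class :: "'a measure \<Rightarrow> ('a \<Rightarrow> 'b::topological_space) \<Rightarrow> ('a \<Rightarrow> 'b) set" where
  "rv_class M f = {g \<in> borel_measurable M. AE w in M. g w = f w}"

definition L0 :: "'a measure \<Rightarrow> ('a \<Rightarrow> 'b::topological_space) set set" where
  "L0 M = rv_class M ` borel_measurable M"

definition rv_rep :: "('a \<Rightarrow> 'b) set \<Rightarrow> 'a \<Rightarrow> 'b" where
  "rv_rep \<xi> = (SOME f. f \<in> \<xi>)"

definition rv_map :: "'a measure \<Rightarrow> ('b \<Rightarrow> 'c::topological_space) \<Rightarrow> ('a \<Rightarrow> 'b) set \<Rightarrow> ('a \<Rightarrow> 'c) set" where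
  "rv_map M h \<xi> = rv_class M (\<lambda>w. h (rv_rep \<xi> w))"

definition rv_map2 :: "'a measure \<Rightarrow> ('b \<Rightarrow> 'c \<Rightarrow> 'd::topological_space) \<Rightarrow>
    ('a \<Rightarrow> 'b) set \<Rightarrow> ('a \<Rightarrow> 'c) set \<Rightarrow> ('a \<Rightarrow> 'd) set" where
  "rv_map2 M h \<xi> \<eta> = rv_class M (\<lambda>w. h (rv_rep \<xi> w) (rv_rep \<eta> w))"

definition rv_le :: "'a measure \<Rightarrow> ('a \<Rightarrow> 'b::ord) set \<Rightarrow> ('a \<Rightarrow> 'b) set \<Rightarrow> bool" where
  "rv_le M \<xi> \<eta> \<longleftrightarrow> (AE w in M. rv_rep \<xi> w \<le> rv_rep \<eta> w)"

definition rv_const :: "'a measure \<Rightarrow> 'b \<Rightarrow> ('a \<Rightarrow> 'b::topological_space) set" where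
  "rv_const M c = rv_class M (\<lambda>_. c)"

definition L0_pos :: "'a measure \<Rightarrow> ('a \<Rightarrow> real) set set" where
  "L0_pos M = {\<xi> \<in> L0 M. rv_le M (rv_const M 0) \<xi>}"

text \<open>The scalar field \<open>K\<close> is a type of sort \<open>{real_normed_field, euclidean_space}\<close>. Its instances
  include \<^typ>\<open>real\<close> and \<^typ>\<open>complex\<close>; by Frobenius' theorem these are the only ones up to
  isomorphism.\<close>

definition L0_ring :: "'a measure \<Rightarrow> ('a \<Rightarrow> 'k::{real_normed_field,euclidean_space}) set ring" where
  "L0_ring M = \<lparr>carrier = L0 M, mult = rv_map2 M (*), one = rv_const M 1,
     zero = rv_const M 0, add = rv_map2 M (+)\<rparr>"

text \<open>The classes of extended real random variables, ordered almost surely; suprema and infima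
  are those of HOL-Algebra for this ordered set.\<close>

definition Lbar :: "'a measure \<Rightarrow> ('a \<Rightarrow> ereal) set gorder" where
  "Lbar M = \<lparr>carrier = L0 M, eq = (=), le = rv_le M\<rparr>"

text \<open>The inclusion of the classes of real random variables into the extended real ones.\<close>

definition to_Lbar :: "'a measure \<Rightarrow> ('a \<Rightarrow> real) set \<Rightarrow> ('a \<Rightarrow> ereal) set" where
  "to_Lbar M = rv_map M ereal"

lemma rv_class_cong:
  assumes "AE w in M. f w = g w"
  shows "rv_class M f = rv_class M g"
  unfolding rv_class_def
proof (intro Collect_cong conj_cong refl iffI)
  fix h assume "AE w in M. h w = f w" then show "AE w in M. h w = g w"
    using assms by eventually_elim simp
next
  fix h assume "AE w in M. h w = g w" then show "AE w in M. h w = f w"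
    using assms by eventually_elim simp
qed

lemma rv_class_in_L0 [simp]: "f \<in> borel_measurable M \<Longrightarrow> rv_class M f \<in> L0 M"
  by (auto simp: L0_def)

lemma rv_rep_class:
  assumes "f \<in> borel_measurable M"
  shows "rv_rep (rv_class M f) \<in> borel_measurable M" "AE w in M. rv_rep (rv_class M f) w = f w"
proof -
  have "rv_rep (rv_class M f) \<in> rv_class M f"
    unfolding rv_rep_def by (rule someI[of _ f]) (use assms in \<open>auto simp: rv_class_def\<close>)
  then show "rv_rep (rv_class M f) \<in> borel_measurable M" "AE w in M. rv_rep (rv_class M f) w = f w"
    by (auto simp: rv_class_def)
qed

lemma L0_cases:
  assumes "\<xi> \<in> L0 M"
  obtains f where "f \<in> borel_measurable M" "\<xi> = rv_class M f"
  using assms by (auto simp: L0_def)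

lemma rv_map2_class:
  assumes "f \<in> borel_measurable M" "g \<in> borel_measurable M"
  shows "rv_map2 M h (rv_class M f) (rv_class M g) = rv_class M (\<lambda>w. h (f w) (g w))"
  unfolding rv_map2_def
  by (rule rv_class_cong)
     (use rv_rep_class(2)[OF assms(1)] rv_rep_class(2)[OF assms(2)] in eventually_elim, simp)

lemma cring_L0_ring:
  "cring (L0_ring M :: ('a \<Rightarrow> 'k::{real_normed_field,euclidean_space}) set ring)"
proof (rule cringI)
  show "abelian_group (L0_ring M :: ('a \<Rightarrow> 'k) set ring)"
  proof (rule abelian_groupI)
    fix x :: "('a \<Rightarrow> 'k) set" assume "x \<in> carrier (L0_ring M)"
    then obtain f where f: "f \<in> borel_measurable M" "x = rv_class M f"
      by (auto simp: L0_ring_def elim: L0_cases)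
    show "\<exists>y\<in>carrier (L0_ring M). y \<oplus>\<^bsub>L0_ring M\<^esub> x = \<zero>\<^bsub>L0_ring M\<^esub>"
      by (rule bexI[of _ "rv_class M (\<lambda>w. - f w)"])
         (use f in \<open>auto simp: L0_ring_def rv_const_def rv_map2_class\<close>)
  qed (auto simp: L0_ring_def rv_const_def rv_map2_class algebra_simps elim!: L0_cases)
  show "comm_monoid (L0_ring M :: ('a \<Rightarrow> 'k) set ring)"
    by (rule comm_monoidI)
       (auto simp: L0_ring_def rv_const_def rv_map2_class algebra_simps elim!: L0_cases)
qed (auto simp: L0_ring_def rv_const_def rv_map2_class algebra_simps elim!: L0_cases)


section \<open>Random normed modules\<close>

record ('a, 'k, 'x) rn_struct = "(('a \<Rightarrow> 'k) set, 'x) module" +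
  l0norm :: "'x \<Rightarrow> ('a \<Rightarrow> real) set"

locale rn_module = prob_space M + module "L0_ring M" X
  for M :: "'a measure"
    and X :: "('a, 'k::{real_normed_field,euclidean_space}, 'x) rn_struct" +
  assumes l0norm_pos: "x \<in> carrier X \<Longrightarrow> l0norm X x \<in> L0_pos M"
    and l0norm_smult: "\<lbrakk>\<xi> \<in> L0 M; x \<in> carrier X\<rbrakk> \<Longrightarrow>
      l0norm X (\<xi> \<odot>\<^bsub>X\<^esub> x) = rv_map2 M (*) (rv_map M norm \<xi>) (l0norm X x)"
    and l0norm_triangle: "\<lbrakk>x \<in> carrier X; y \<in> carrier X\<rbrakk> \<Longrightarrow>
      rv_le M (l0norm X (x \<oplus>\<^bsub>X\<^esub> y)) (rv_map2 M (+) (l0norm X x) (l0norm X y))"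
    and l0norm_eq_0: "\<lbrakk>x \<in> carrier X; l0norm X x = rv_const M 0\<rbrakk> \<Longrightarrow> x = \<zero>\<^bsub>X\<^esub>"

definition el_nbhd :: "'a measure \<Rightarrow> ('a, 'k, 'x) rn_struct \<Rightarrow> real \<Rightarrow> real \<Rightarrow> 'x set" where
  "el_nbhd M X \<epsilon> \<delta> = {z \<in> carrier X. measure M {w \<in> space M. rv_rep (l0norm X z) w < \<epsilon>} > \<delta>}"

definition el_topology :: "'a measure \<Rightarrow> ('a, 'k, 'x) rn_struct \<Rightarrow> 'x topology" where
  "el_topology M X = topology (\<lambda>U. U \<subseteq> carrier X \<and>
     (\<forall>x\<in>U. \<exists>\<epsilon> \<delta>. 0 < \<epsilon> \<and> 0 < \<delta> \<and> \<delta> < 1 \<and> {y \<in> carrier X. y \<ominus>\<^bsub>X\<^esub> x \<in> el_nbhd M X \<epsilon> \<delta>} \<subseteq> U))"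

lemma (in rn_module) el_nbhd_mono:
  assumes "z \<in> el_nbhd M X \<epsilon> \<delta>" "\<epsilon> \<le> \<epsilon>'" "\<delta>' \<le> \<delta>"
  shows "z \<in> el_nbhd M X \<epsilon>' \<delta>'"
proof -
  have z: "z \<in> carrier X" "\<delta> < measure M {w \<in> space M. rv_rep (l0norm X z) w < \<epsilon>}"
    using assms(1) by (auto simp: el_nbhd_def)
  have "l0norm X z \<in> L0 M" using l0norm_pos[OF z(1)] by (simp add: L0_pos_def)
  then have [measurable]: "rv_rep (l0norm X z) \<in> borel_measurable M"
    by (auto elim!: L0_cases intro: rv_rep_class)
  have "measure M {w \<in> space M. rv_rep (l0norm X z) w < \<epsilon>}
      \<le> measure M {w \<in> space M. rv_rep (l0norm X z) w < \<epsilon>'}"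
    by (rule finite_measure_mono) (use assms(2) in auto)
  then show ?thesis using z assms(3) by (auto simp: el_nbhd_def)
qed

lemma (in rn_module) openin_el_topology:
  "openin (el_topology M X) U \<longleftrightarrow> U \<subseteq> carrier X \<and>
     (\<forall>x\<in>U. \<exists>\<epsilon> \<delta>. 0 < \<epsilon> \<and> 0 < \<delta> \<and> \<delta> < 1 \<and> {y \<in> carrier X. y \<ominus>\<^bsub>X\<^esub> x \<in> el_nbhd M X \<epsilon> \<delta>} \<subseteq> U)"
  (is "_ \<longleftrightarrow> ?O U")
proof -
  have "istopology ?O"
    unfolding istopology_def
  proof (intro conjI allI impI)
    fix S T assume S: "?O S" and T: "?O T"
    show "S \<inter> T \<subseteq> carrier X" using S by blast
    show "\<forall>x\<in>S \<inter> T. \<exists>\<epsilon> \<delta>. 0 < \<epsilon> \<and> 0 < \<delta> \<and> \<delta> < 1 \<and>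
        {y \<in> carrier X. y \<ominus>\<^bsub>X\<^esub> x \<in> el_nbhd M X \<epsilon> \<delta>} \<subseteq> S \<inter> T"
    proof
      fix x assume x: "x \<in> S \<inter> T"
      obtain e1 l1 where 1: "0 < e1" "0 < l1" "l1 < 1"
        "{y \<in> carrier X. y \<ominus>\<^bsub>X\<^esub> x \<in> el_nbhd M X e1 l1} \<subseteq> S" using S x by blast
      obtain e2 l2 where 2: "0 < e2" "0 < l2" "l2 < 1"
        "{y \<in> carrier X. y \<ominus>\<^bsub>X\<^esub> x \<in> el_nbhd M X e2 l2} \<subseteq> T" using T x by blast
      have "y \<in> S \<inter> T" if "y \<in> carrier X" "y \<ominus>\<^bsub>X\<^esub> x \<in> el_nbhd M X (min e1 e2) (max l1 l2)" for y
      proof -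
        have "y \<ominus>\<^bsub>X\<^esub> x \<in> el_nbhd M X e1 l1" "y \<ominus>\<^bsub>X\<^esub> x \<in> el_nbhd M X e2 l2"
          by (rule el_nbhd_mono[OF that(2)]; simp)+
        then show ?thesis using 1(4) 2(4) that(1) by blast
      qed
      then show "\<exists>\<epsilon> \<delta>. 0 < \<epsilon> \<and> 0 < \<delta> \<and> \<delta> < 1 \<and>
          {y \<in> carrier X. y \<ominus>\<^bsub>X\<^esub> x \<in> el_nbhd M X \<epsilon> \<delta>} \<subseteq> S \<inter> T"
        using 1 2 by (intro exI[of _ "min e1 e2"] exI[of _ "max l1 l2"]) auto
    qed
  next
    fix \<K> assume K: "\<forall>K\<in>\<K>. ?O K"
    show "\<Union>\<K> \<subseteq> carrier X" using K by blast
    show "\<forall>x\<in>\<Union>\<K>. \<exists>\<epsilon> \<delta>. 0 < \<epsilon> \<and> 0 < \<delta> \<and> \<delta> < 1 \<and>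
        {y \<in> carrier X. y \<ominus>\<^bsub>X\<^esub> x \<in> el_nbhd M X \<epsilon> \<delta>} \<subseteq> \<Union>\<K>"
    proof
      fix x assume "x \<in> \<Union>\<K>"
      then obtain K where "K \<in> \<K>" "x \<in> K" by blast
      then obtain e l where "0 < e" "0 < l" "l < 1"
        "{y \<in> carrier X. y \<ominus>\<^bsub>X\<^esub> x \<in> el_nbhd M X e l} \<subseteq> K" using K by blast
      then show "\<exists>\<epsilon> \<delta>. 0 < \<epsilon> \<and> 0 < \<delta> \<and> \<delta> < 1 \<and>
          {y \<in> carrier X. y \<ominus>\<^bsub>X\<^esub> x \<in> el_nbhd M X \<epsilon> \<delta>} \<subseteq> \<Union>\<K>"
        using \<open>K \<in> \<K>\<close> by blast
    qed
  qed
  then show ?thesis by (simp add: el_topology_def topology_inverse')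
qed

text \<open>The topology being metrizable and linear, completeness is expressed by sequences that are
  Cauchy for its translation-invariant uniformity.\<close>

definition rn_complete :: "'a measure \<Rightarrow> ('a, 'k, 'x) rn_struct \<Rightarrow> bool" where
  "rn_complete M X \<longleftrightarrow> (\<forall>z :: nat \<Rightarrow> 'x. range z \<subseteq> carrier X \<longrightarrow>
     (\<forall>\<epsilon> \<delta>. 0 < \<epsilon> \<and> 0 < \<delta> \<and> \<delta> < 1 \<longrightarrow>
        (\<exists>N. \<forall>m\<ge>N. \<forall>n\<ge>N. z m \<ominus>\<^bsub>X\<^esub> z n \<in> el_nbhd M X \<epsilon> \<delta>)) \<longrightarrow>
     (\<exists>l. limitin (el_topology M X) z l sequentially))"


section \<open>Almost surely bounded operators\<close>

definition K_linear :: "'a measure \<Rightarrow> ('a, 'k::{real_normed_field,euclidean_space}, 'x) rn_struct \<Rightarrow>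
    ('x \<Rightarrow> 'x) \<Rightarrow> bool" where
  "K_linear M X T \<longleftrightarrow> T \<in> carrier X \<rightarrow> carrier X \<and>
     (\<forall>x\<in>carrier X. \<forall>y\<in>carrier X. T (x \<oplus>\<^bsub>X\<^esub> y) = T x \<oplus>\<^bsub>X\<^esub> T y) \<and>
     (\<forall>c. \<forall>x\<in>carrier X. T (rv_const M c \<odot>\<^bsub>X\<^esub> x) = rv_const M c \<odot>\<^bsub>X\<^esub> T x)"

definition op_bounds :: "'a measure \<Rightarrow> ('a, 'k, 'x) rn_struct \<Rightarrow> ('x \<Rightarrow> 'x) \<Rightarrow> ('a \<Rightarrow> real) set set" where
  "op_bounds M X T = {\<eta> \<in> L0_pos M. \<forall>z\<in>carrier X.
     rv_le M (l0norm X (T z)) (rv_map2 M (*) \<eta> (l0norm X z))}"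

definition bounded_ops :: "'a measure \<Rightarrow> ('a, 'k::{real_normed_field,euclidean_space}, 'x) rn_struct \<Rightarrow>
    ('x \<Rightarrow> 'x) set" where
  "bounded_ops M X = {T. K_linear M X T \<and> op_bounds M X T \<noteq> {}}"

definition op_norm :: "'a measure \<Rightarrow> ('a, 'k, 'x) rn_struct \<Rightarrow> ('x \<Rightarrow> 'x) \<Rightarrow> ('a \<Rightarrow> ereal) set" where
  "op_norm M X T = \<Sqinter>\<^bsub>Lbar M\<^esub> (to_Lbar M ` op_bounds M X T)"


section \<open>C-semigroups\<close>

text \<open>Operators are functions on the type \<open>'x\<close> whose values outside the carrier are irrelevant, so
  operator identities are required on the carrier only.\<close>

definition C_semigroup :: "'a measure \<Rightarrow> ('a, 'k::{real_normed_field,euclidean_space}, 'x) rn_struct \<Rightarrow>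
    ('x \<Rightarrow> 'x) \<Rightarrow> (real \<Rightarrow> 'x \<Rightarrow> 'x) \<Rightarrow> bool" where
  "C_semigroup M X C V \<longleftrightarrow>
     C \<in> bounded_ops M X \<and> inj_on C (carrier X) \<and>
     (\<forall>s\<ge>0. V s \<in> bounded_ops M X) \<and>
     (\<forall>z\<in>carrier X. continuous_map (top_of_set {0..}) (el_topology M X) (\<lambda>s. V s z)) \<and>
     (\<forall>z\<in>carrier X. V 0 z = C z) \<and>
     (\<forall>s\<ge>0. \<forall>t\<ge>0. \<forall>z\<in>carrier X. C (V (s + t) z) = V s (V t z))"

definition locally_as_bounded :: "'a measure \<Rightarrow> ('a, 'k, 'x) rn_struct \<Rightarrow>
    (real \<Rightarrow> 'x \<Rightarrow> 'x) \<Rightarrow> bool" where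
  "locally_as_bounded M X V \<longleftrightarrow>
     (\<forall>l>0. \<Squnion>\<^bsub>Lbar M\<^esub> ((\<lambda>s. op_norm M X (V s)) ` {0..l}) \<in> to_Lbar M ` L0_pos M)"

definition diff_quot :: "'a measure \<Rightarrow> ('a, 'k::{real_normed_field,euclidean_space}, 'x) rn_struct \<Rightarrow>
    ('x \<Rightarrow> 'x) \<Rightarrow> (real \<Rightarrow> 'x \<Rightarrow> 'x) \<Rightarrow> real \<Rightarrow> 'x \<Rightarrow> 'x" where
  "diff_quot M X C V s z = rv_const M (of_real (1 / s)) \<odot>\<^bsub>X\<^esub> (V s z \<ominus>\<^bsub>X\<^esub> C z)"

definition is_generator :: "'a measure \<Rightarrow> ('a, 'k::{real_normed_field,euclidean_space}, 'x) rn_struct \<Rightarrow>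
    ('x \<Rightarrow> 'x) \<Rightarrow> (real \<Rightarrow> 'x \<Rightarrow> 'x) \<Rightarrow> ('x \<Rightarrow> 'x) \<Rightarrow> 'x set \<Rightarrow> bool" where
  "is_generator M X C V A D \<longleftrightarrow>
     D = {z \<in> carrier X. \<exists>y \<in> C ` carrier X.
            limitin (el_topology M X) (\<lambda>s. diff_quot M X C V s z) y (at_right 0)} \<and>
     (\<forall>z\<in>D. A z = the_inv_into (carrier X) C
            (THE y. limitin (el_topology M X) (\<lambda>s. diff_quot M X C V s z) y (at_right 0)))"

end

theory Submission
  imports Defs "HOL-Real_Asymp.Real_Asymp"
begin

text \<open>Let \<open>m\<close> bound \<open>\<parallel>V s\<parallel>\<close> for \<open>s \<in> [0, l]\<close>, and let \<open>y\<close> be the limit of \<open>A\<^sub>s z\<close> as \<open>s \<down> 0\<close>.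
  Telescoping \<open>C (V (n s) - C) z\<close> into the increments \<open>V (k s) (V s - C) z\<close> with \<open>k < n\<close> and
  taking \<open>s = t / n\<close> gives \<open>\<parallel>C A\<^sub>t z\<parallel> \<le> m \<parallel>A\<^bsub>t/n\<^esub> z\<parallel>\<close> almost surely, and letting \<open>n \<rightarrow> \<infinity>\<close> in
  probability, \<open>\<parallel>C A\<^sub>t z\<parallel> \<le> m \<parallel>y\<parallel>\<close> for every \<open>t \<in> (0, l]\<close>.\<close>

section \<open>The lattice of extended real random variables\<close>

lemma rv_rep_measurable: "\<xi> \<in> L0 M \<Longrightarrow> rv_rep \<xi> \<in> borel_measurable M"
  by (auto elim!: L0_cases intro: rv_rep_class)

lemma rv_class_rep: "\<xi> \<in> L0 M \<Longrightarrow> rv_class M (rv_rep \<xi>) = \<xi>"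
  by (elim L0_cases, hypsubst, rule rv_class_cong) (rule rv_rep_class)

text \<open>The chosen representatives differ from \<open>f\<close> and \<open>g\<close> only on a
  null set, so the order of classes can be tested on any measurable representatives.\<close>

lemma rv_le_class_iff:
  assumes "f \<in> borel_measurable M" "g \<in> borel_measurable M"
  shows "rv_le M (rv_class M f) (rv_class M g) \<longleftrightarrow> (AE w in M. f w \<le> g w)"
proof -
  have "AE w in M. rv_rep (rv_class M f) w = f w \<and> rv_rep (rv_class M g) w = g w"
    using assms by (simp add: rv_rep_class)
  then have "(AE w in M. rv_rep (rv_class M f) w \<le> rv_rep (rv_class M g) w)
      \<longleftrightarrow> (AE w in M. f w \<le> g w)"
    by (intro iffI; elim AE_mp; elim AE_mp; intro AE_I2; simp)
  then show ?thesis by (simp add: rv_le_def)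
qed

lemma to_Lbar_in_L0: "\<xi> \<in> L0 M \<Longrightarrow> to_Lbar M \<xi> \<in> L0 M"
  unfolding to_Lbar_def rv_map_def
  by (intro rv_class_in_L0 borel_measurable_ereal rv_rep_measurable)

lemma rv_rep_to_Lbar:
  "\<xi> \<in> L0 M \<Longrightarrow> AE w in M. rv_rep (to_Lbar M \<xi>) w = ereal (rv_rep \<xi> w)"
  unfolding to_Lbar_def rv_map_def
  by (intro rv_rep_class borel_measurable_ereal rv_rep_measurable)

lemma L0_posD:
  assumes "\<xi> \<in> L0_pos M"
  shows "\<xi> \<in> L0 M" "AE w in M. 0 \<le> rv_rep \<xi> w"
proof -
  show L: "\<xi> \<in> L0 M" using assms by (simp add: L0_pos_def)
  have "rv_le M (rv_class M (\<lambda>_. 0)) (rv_class M (rv_rep \<xi>))"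
    using assms by (simp add: L0_pos_def rv_const_def rv_class_rep)
  then show "AE w in M. 0 \<le> rv_rep \<xi> w"
    using L by (simp add: rv_le_class_iff rv_rep_measurable)
qed

lemma rv_class_in_L0_pos:
  assumes "f \<in> borel_measurable M" "AE w in M. 0 \<le> f w"
  shows "rv_class M f \<in> L0_pos M"
  using assms by (simp add: L0_pos_def rv_const_def rv_le_class_iff)

lemma partial_order_Lbar: "partial_order (Lbar M)"
proof
  fix x y assume "x \<in> carrier (Lbar M)" "y \<in> carrier (Lbar M)"
    and "x \<sqsubseteq>\<^bsub>Lbar M\<^esub> y" "y \<sqsubseteq>\<^bsub>Lbar M\<^esub> x"
  then have L: "x \<in> L0 M" "y \<in> L0 M" and le: "rv_le M x y" "rv_le M y x"
    by (auto simp: Lbar_def)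
  have "AE w in M. rv_rep x w = rv_rep y w"
    using le unfolding rv_le_def by eventually_elim simp
  then have "rv_class M (rv_rep x) = rv_class M (rv_rep y)" by (rule rv_class_cong)
  then show "x .=\<^bsub>Lbar M\<^esub> y" using L by (simp add: rv_class_rep Lbar_def)
next
  fix x y z assume "x \<sqsubseteq>\<^bsub>Lbar M\<^esub> y" "y \<sqsubseteq>\<^bsub>Lbar M\<^esub> z"
  then have "rv_le M x y" "rv_le M y z" by (auto simp: Lbar_def)
  then have "rv_le M x z" unfolding rv_le_def by eventually_elim simp
  then show "x \<sqsubseteq>\<^bsub>Lbar M\<^esub> z" by (simp add: Lbar_def)
qed (auto simp: Lbar_def rv_le_def)

text \<open>A bounded, strictly increasing encoding of the extended reals: expectations always
  exist, and equality of codes gives back equality of values. The codes \<open>2\<close> and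
  \<open>- 2\<close> of the infinities lie outside the range of \<open>arctan\<close> because
  \<open>pi / 2 < 2\<close>.\<close>

definition squash :: "ereal \<Rightarrow> real" where
  "squash x = (if x = \<infinity> then 2 else if x = - \<infinity> then - 2 else arctan (real_of_ereal x))"

lemma squash_measurable [measurable]: "squash \<in> borel_measurable borel"
  unfolding squash_def by measurable

lemma abs_squash_le: "\<bar>squash x\<bar> \<le> 2"
proof -
  have "\<bar>arctan y\<bar> \<le> 2" for y using arctan_bounded[of y] pi_half_less_two by linarith
  then show ?thesis by (simp add: squash_def)
qed

lemma strict_mono_squash: "strict_mono squash"
proof (rule strict_monoI)
  fix x y :: ereal assume "x < y"
  moreover have "- 2 < arctan a" "arctan a < 2" for a
    using arctan_bounded[of a] pi_half_less_two by linarith+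
  ultimately show "squash x < squash y"
    by (cases x; cases y) (auto simp: squash_def arctan_less_iff)
qed

text \<open>Exhaustion: since \<^const>\<open>squash\<close> is bounded and strictly increasing, a countable subfamily
  whose pointwise infimum has the least possible \<^const>\<open>squash\<close>-expectation already attains the
  infimum of the whole family.\<close>

lemma (in prob_space) Lbar_Inf_exists:
  assumes A: "A \<subseteq> L0 M"
  shows "\<exists>i. greatest (Lbar M) i (Lower (Lbar M) A)"
proof -
  define g where "g J w = (INF \<xi>\<in>J. rv_rep \<xi> w :: ereal)" for J and w :: 'a
  define I where "I J = expectation (\<lambda>w. squash (g J w))" for J
  define \<J> where "\<J> = {J. J \<subseteq> A \<and> countable J}"
  have gm [measurable]: "g J \<in> borel_measurable M" if "J \<in> \<J>" for J
    unfolding g_def using that A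
    by (intro borel_measurable_INF) (auto simp: \<J>_def intro: rv_rep_measurable)
  have int: "integrable M (\<lambda>w. squash (g J w))" if "J \<in> \<J>" for J
    using that by (intro integrable_const_bound[of _ 2]) (auto simp: abs_squash_le)
  have mono: "I K \<le> I J" if "J \<in> \<J>" "K \<in> \<J>" "J \<subseteq> K" for J K
    unfolding I_def
  proof (intro integral_mono int that)
    fix w show "squash (g K w) \<le> squash (g J w)"
      unfolding g_def
      by (intro monoD[OF strict_mono_mono[OF strict_mono_squash]] INF_superset_mono that order_refl)
  qed
  define c where "c = (INF J\<in>\<J>. I J)"
  have bdd: "bdd_below (I ` \<J>)"
  proof (rule bdd_belowI2)
    fix J assume J: "J \<in> \<J>"
    have "expectation (\<lambda>w. - 2) \<le> I J"
      unfolding I_def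
    proof (intro integral_mono int J)
      show "- 2 \<le> squash (g J w)" for w using abs_squash_le[of "g J w"] by linarith
    qed simp
    then show "- 2 \<le> I J" by (simp add: prob_space)
  qed
  have ne: "\<J> \<noteq> {}" by (auto simp: \<J>_def)
  have "\<exists>J\<in>\<J>. I J < c + 1 / Suc n" for n
    using cINF_less_iff[OF ne bdd, of "c + 1 / Suc n"] unfolding c_def[symmetric] by simp
  then obtain J where J: "\<And>n. J n \<in> \<J>" "\<And>n. I (J n) < c + 1 / Suc n" by metis
  \<comment> \<open>The union of the minimizing families is still countable, and its infimum lies
    below each of theirs, so it attains the minimum \<open>c\<close>.\<close>
  define U where "U = (\<Union>n. J n)"
  have U: "U \<in> \<J>" using J(1) by (auto simp: U_def \<J>_def)
  have "I U \<le> c"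
  proof (rule field_le_epsilon)
    fix e :: real assume "e > 0"
    then obtain n where "1 / Suc n < e" using nat_approx_posE by (metis)
    moreover have "I U \<le> I (J n)" by (rule mono[OF J(1) U]) (auto simp: U_def)
    ultimately show "I U \<le> c + e" using J(2)[of n] by linarith
  qed
  have lower: "AE w in M. g U w \<le> rv_rep \<xi> w" if "\<xi> \<in> A" for \<xi>
  proof -
    let ?K = "insert \<xi> U"
    have K: "?K \<in> \<J>" using that U by (auto simp: \<J>_def)
    have le: "squash (g ?K w) \<le> squash (g U w)" for w
      unfolding g_def
      by (intro monoD[OF strict_mono_mono[OF strict_mono_squash]] INF_superset_mono) auto
    \<comment> \<open>Adjoining \<open>\<xi>\<close> can only lower the infimum, yet
      \<open>I U\<close> is already minimal. Hence the nonnegative difference of the codes has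
      integral 0 and vanishes almost surely, and injectivity of \<open>squash\<close> does the
      rest.\<close>
    have "I U \<le> I ?K"
      using \<open>I U \<le> c\<close> cINF_lower[OF bdd K] by (simp add: c_def)
    then have "expectation (\<lambda>w. squash (g U w) - squash (g ?K w)) = 0"
      using mono[OF U K subset_insertI] int[OF U] int[OF K] by (auto simp: I_def)
    then have "AE w in M. squash (g U w) - squash (g ?K w) = 0"
      using le int[OF U] int[OF K] by (subst (asm) integral_nonneg_eq_0_iff_AE) auto
    then show ?thesis
    proof eventually_elim
      case (elim w)
      then have "g U w = g ?K w"
        using strict_mono_eq[OF strict_mono_squash] by simp
      also have "\<dots> \<le> rv_rep \<xi> w" by (simp add: g_def)
      finally show ?case .
    qed
  qed
  have "greatest (Lbar M) (rv_class M (g U)) (Lower (Lbar M) A)"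
    unfolding greatest_def
  proof (intro conjI ballI)
    show "rv_class M (g U) \<in> Lower (Lbar M) A"
    proof (rule Lower_memI)
      fix \<xi> assume \<xi>: "\<xi> \<in> A"
      then have "rv_le M (rv_class M (g U)) (rv_class M (rv_rep \<xi>))"
        using lower U A by (subst rv_le_class_iff) (auto intro: rv_rep_measurable)
      then show "rv_class M (g U) \<sqsubseteq>\<^bsub>Lbar M\<^esub> \<xi>"
        using \<xi> A by (auto simp: Lbar_def rv_class_rep subset_iff)
    qed (use U in \<open>simp add: Lbar_def\<close>)
  next
    fix x assume x: "x \<in> Lower (Lbar M) A"
    then have L: "x \<in> L0 M" by (auto simp: Lower_def Lbar_def)
    have "\<forall>\<xi>\<in>U. AE w in M. rv_rep x w \<le> rv_rep \<xi> w"
      using x U A by (auto simp: Lower_def Lbar_def \<J>_def rv_le_def)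
    then have "AE w in M. \<forall>\<xi>\<in>U. rv_rep x w \<le> rv_rep \<xi> w"
      using U by (subst AE_ball_countable) (auto simp: \<J>_def)
    then have "AE w in M. rv_rep x w \<le> g U w"
      by eventually_elim (auto simp: g_def intro: INF_greatest)
    then have "rv_le M (rv_class M (rv_rep x)) (rv_class M (g U))"
      using U L by (subst rv_le_class_iff) (auto intro: rv_rep_measurable)
    then show "x \<sqsubseteq>\<^bsub>Lbar M\<^esub> rv_class M (g U)"
      using L by (simp add: Lbar_def rv_class_rep)
  qed (auto simp: Lower_def)
  then show ?thesis by blast
qed

section \<open>Completeness of \<open>Lbar M\<close> and its suprema and infima\<close>

lemma (in prob_space) complete_lattice_Lbar: "complete_lattice (Lbar M)"
proof (rule partial_order.complete_lattice_criterion1[OF partial_order_Lbar])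
  \<comment> \<open>Besides infima the criterion asks for a greatest element, which is the infimum
    of the empty family.\<close>
  have "Lower (Lbar M) {} = carrier (Lbar M)" by simp
  then show "\<exists>g. greatest (Lbar M) g (carrier (Lbar M))"
    using Lbar_Inf_exists[of "{}"] by simp
  show "\<exists>i. greatest (Lbar M) i (Lower (Lbar M) A)" if "A \<subseteq> carrier (Lbar M)" for A
    using Lbar_Inf_exists[of A] that by (simp add: Lbar_def)
qed

text \<open>The supremum is defined by choice among least upper bounds, so these properties follow
  from the existence that completeness provides.\<close>

lemma (in prob_space) Lbar_Sup:
  assumes "A \<subseteq> L0 M"
  shows "\<Squnion>\<^bsub>Lbar M\<^esub> A \<in> L0 M"
    and "\<And>\<xi>. \<xi> \<in> A \<Longrightarrow> rv_le M \<xi> (\<Squnion>\<^bsub>Lbar M\<^esub> A)"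
    and "\<And>\<eta>. \<lbrakk>\<eta> \<in> L0 M; \<And>\<xi>. \<xi> \<in> A \<Longrightarrow> rv_le M \<xi> \<eta>\<rbrakk> \<Longrightarrow> rv_le M (\<Squnion>\<^bsub>Lbar M\<^esub> A) \<eta>"
proof -
  interpret complete_lattice "Lbar M" by (rule complete_lattice_Lbar)
  have "A \<subseteq> carrier (Lbar M)" using assms by (simp add: Lbar_def)
  from someI_ex[OF sup_exists[OF this]]
  have "least (Lbar M) (\<Squnion>\<^bsub>Lbar M\<^esub> A) (Upper (Lbar M) A)" by (simp add: sup_def)
  then show "\<Squnion>\<^bsub>Lbar M\<^esub> A \<in> L0 M"
    and "\<And>\<xi>. \<xi> \<in> A \<Longrightarrow> rv_le M \<xi> (\<Squnion>\<^bsub>Lbar M\<^esub> A)"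
    and "\<And>\<eta>. \<lbrakk>\<eta> \<in> L0 M; \<And>\<xi>. \<xi> \<in> A \<Longrightarrow> rv_le M \<xi> \<eta>\<rbrakk> \<Longrightarrow> rv_le M (\<Squnion>\<^bsub>Lbar M\<^esub> A) \<eta>"
    using assms unfolding least_def Upper_def Lbar_def by auto
qed

lemma (in prob_space) Lbar_Inf:
  assumes "A \<subseteq> L0 M"
  shows "\<Sqinter>\<^bsub>Lbar M\<^esub> A \<in> L0 M"
    and "\<And>\<eta>. \<lbrakk>\<eta> \<in> L0 M; \<And>\<xi>. \<xi> \<in> A \<Longrightarrow> rv_le M \<eta> \<xi>\<rbrakk> \<Longrightarrow> rv_le M \<eta> (\<Sqinter>\<^bsub>Lbar M\<^esub> A)"
proof -
  from someI_ex[OF Lbar_Inf_exists[OF assms]]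
  have "greatest (Lbar M) (\<Sqinter>\<^bsub>Lbar M\<^esub> A) (Lower (Lbar M) A)" by (simp add: inf_def)
  then show "\<Sqinter>\<^bsub>Lbar M\<^esub> A \<in> L0 M"
    and "\<And>\<eta>. \<lbrakk>\<eta> \<in> L0 M; \<And>\<xi>. \<xi> \<in> A \<Longrightarrow> rv_le M \<eta> \<xi>\<rbrakk> \<Longrightarrow> rv_le M \<eta> (\<Sqinter>\<^bsub>Lbar M\<^esub> A)"
    using assms unfolding greatest_def Lower_def Lbar_def by auto
qed

text \<open>Any member of the family bounds the supremum below by 0, and \<open>\<eta>\<close>
  bounds it above by a real variable; so it is almost surely finite and comes from a real
  class.\<close>

lemma (in prob_space) Lbar_Sup_in_L0_pos:
  assumes "A \<noteq> {}" "A \<subseteq> to_Lbar M ` L0_pos M" "\<eta> \<in> L0 M"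
    and le: "\<And>\<xi>. \<xi> \<in> A \<Longrightarrow> rv_le M \<xi> (to_Lbar M \<eta>)"
  shows "\<Squnion>\<^bsub>Lbar M\<^esub> A \<in> to_Lbar M ` L0_pos M"
proof -
  let ?S = "\<Squnion>\<^bsub>Lbar M\<^esub> A"
  have A: "A \<subseteq> L0 M" using assms(2) by (auto intro!: to_Lbar_in_L0 dest: L0_posD)
  note S = Lbar_Sup[OF A]
  obtain \<xi> where \<xi>: "\<xi> \<in> L0_pos M" "to_Lbar M \<xi> \<in> A" using assms(1,2) by blast
  have "rv_le M ?S (to_Lbar M \<eta>)" by (rule S(3)[OF to_Lbar_in_L0 le]) (use assms in auto)
  then have "AE w in M. rv_rep ?S w \<le> ereal (rv_rep \<eta> w)"
    using rv_rep_to_Lbar[OF assms(3)] unfolding rv_le_def by eventually_elim simp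
  moreover have "AE w in M. 0 \<le> rv_rep ?S w"
    using S(2)[OF \<xi>(2)] rv_rep_to_Lbar[OF L0_posD(1)[OF \<xi>(1)]] L0_posD(2)[OF \<xi>(1)]
    unfolding rv_le_def
  proof eventually_elim
    case (elim w)
    then show ?case by (metis ereal_less_eq(5) order_trans)
  qed
  ultimately have fin: "AE w in M. 0 \<le> rv_rep ?S w \<and> ereal (real_of_ereal (rv_rep ?S w)) = rv_rep ?S w"
  proof eventually_elim
    case (elim w)
    then show ?case by (cases "rv_rep ?S w") auto
  qed
  \<comment> \<open>\<open>real_of_ereal\<close> sends infinite values to 0, but these occur only on
    a null set.\<close>
  define f where "f w = real_of_ereal (rv_rep ?S w)" for w
  have f [measurable]: "f \<in> borel_measurable M"
    using rv_rep_measurable[OF S(1)] unfolding f_def by measurable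
  have "rv_class M f \<in> L0_pos M"
    using fin by (intro rv_class_in_L0_pos f) (auto simp: f_def elim!: AE_mp real_of_ereal_pos)
  moreover have "to_Lbar M (rv_class M f) = ?S"
  proof -
    have "to_Lbar M (rv_class M f) = rv_class M (rv_rep ?S)"
      unfolding to_Lbar_def rv_map_def
      by (rule rv_class_cong) (use rv_rep_class(2)[OF f] fin in eventually_elim, simp add: f_def)
    then show ?thesis using S(1) by (simp add: rv_class_rep)
  qed
  ultimately show ?thesis by (metis image_eqI)
qed

section \<open>Random norms and bounded operators\<close>

context rn_module
begin

abbreviation N where "N x \<equiv> rv_rep (l0norm X x)"

lemma l0norm_in_L0: "x \<in> carrier X \<Longrightarrow> l0norm X x \<in> L0 M"
  by (intro L0_posD l0norm_pos)

lemma N_measurable [measurable]: "x \<in> carrier X \<Longrightarrow> N x \<in> borel_measurable M"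
  by (intro rv_rep_measurable l0norm_in_L0)

lemma N_nonneg: "x \<in> carrier X \<Longrightarrow> AE w in M. 0 \<le> N x w"
  by (intro L0_posD l0norm_pos)

lemma N_triangle:
  assumes [measurable]: "x \<in> carrier X" "y \<in> carrier X"
  shows "AE w in M. N (x \<oplus>\<^bsub>X\<^esub> y) w \<le> N x w + N y w"
proof -
  have "(\<lambda>w. N x w + N y w) \<in> borel_measurable M" by measurable
  from rv_rep_class(2)[OF this] l0norm_triangle[OF assms] show ?thesis
    unfolding rv_le_def rv_map2_def by eventually_elim simp
qed

lemma diff_add_diff:
  assumes "x \<in> carrier X" "y \<in> carrier X" "u \<in> carrier X"
  shows "(x \<ominus>\<^bsub>X\<^esub> y) \<oplus>\<^bsub>X\<^esub> (y \<ominus>\<^bsub>X\<^esub> u) = x \<ominus>\<^bsub>X\<^esub> u"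
  using assms by (simp add: a_minus_def M.a_assoc M.r_neg1 M.r_neg2)

lemma N_diff_triangle:
  assumes "x \<in> carrier X" "y \<in> carrier X" "u \<in> carrier X"
  shows "AE w in M. N (x \<ominus>\<^bsub>X\<^esub> u) w \<le> N (x \<ominus>\<^bsub>X\<^esub> y) w + N (y \<ominus>\<^bsub>X\<^esub> u) w"
  using N_triangle[of "x \<ominus>\<^bsub>X\<^esub> y" "y \<ominus>\<^bsub>X\<^esub> u"] assms by (simp add: diff_add_diff)

lemma N_scale:
  assumes [measurable]: "x \<in> carrier X"
  shows "AE w in M. N (rv_const M c \<odot>\<^bsub>X\<^esub> x) w = norm c * N x w"
proof -
  have c: "rv_const M c \<in> L0 M" by (simp add: rv_const_def)
  have m1: "(\<lambda>w. norm (rv_rep (rv_const M c) w)) \<in> borel_measurable M"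
    using rv_rep_measurable[OF c] by measurable
  let ?n = "rv_map M norm (rv_const M c)"
  have "?n \<in> L0 M" unfolding rv_map_def using m1 by simp
  then have m2: "(\<lambda>w. rv_rep ?n w * N x w) \<in> borel_measurable M"
    using rv_rep_measurable[of ?n] by measurable
  have "AE w in M. rv_rep (rv_const M c) w = c"
    unfolding rv_const_def by (rule rv_rep_class) simp
  moreover have "AE w in M. rv_rep ?n w = norm (rv_rep (rv_const M c) w)"
    unfolding rv_map_def by (rule rv_rep_class[OF m1])
  ultimately show ?thesis
    using rv_rep_class(2)[OF m2]
    unfolding l0norm_smult[OF c assms] rv_map2_def by eventually_elim simp
qed

text \<open>The quotient \<open>N (T x) / N x\<close> lies below every bound of \<open>T\<close>,
  hence below their lattice infimum and below \<open>m\<close>. This avoids proving that the infimum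
  is itself a bound.\<close>

lemma N_le_of_op_norm_le:
  assumes T: "T \<in> bounded_ops M X" and x: "x \<in> carrier X"
    and m: "m \<in> L0 M" "rv_le M (op_norm M X T) (to_Lbar M m)"
  shows "AE w in M. N (T x) w \<le> rv_rep m w * N x w"
proof -
  have Tx: "T x \<in> carrier X" using T x by (auto simp: bounded_ops_def K_linear_def)
  have bound: "AE w in M. N (T x) w \<le> rv_rep \<eta> w * N x w" if "\<eta> \<in> op_bounds M X T" for \<eta>
  proof -
    have \<eta>: "\<eta> \<in> L0 M" "rv_le M (l0norm X (T x)) (rv_map2 M (*) \<eta> (l0norm X x))"
      using that x L0_posD(1) by (auto simp: op_bounds_def)
    have "(\<lambda>w. rv_rep \<eta> w * N x w) \<in> borel_measurable M"
      using rv_rep_measurable[OF \<eta>(1)] N_measurable[OF x] by measurable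
    from rv_rep_class(2)[OF this] \<eta>(2) show ?thesis
      unfolding rv_le_def rv_map2_def by eventually_elim simp
  qed
  obtain \<eta> where \<eta>: "\<eta> \<in> op_bounds M X T" using T by (auto simp: bounded_ops_def)
  \<comment> \<open>Where \<open>N x\<close> vanishes, the default \<open>- \<infinity>\<close>
    imposes nothing; there the fixed bound \<open>\<eta>\<close> forces
    \<open>N (T x) \<le> 0\<close>.\<close>
  define r where "r w = (if N x w > 0 then ereal (N (T x) w / N x w) else - \<infinity>)" for w
  have r [measurable]: "r \<in> borel_measurable M"
    using x Tx unfolding r_def by measurable
  have L: "to_Lbar M ` op_bounds M X T \<subseteq> L0 M"
    by (auto simp: op_bounds_def intro!: to_Lbar_in_L0 L0_posD)
  have "rv_le M (rv_class M r) (op_norm M X T)"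
    unfolding op_norm_def
  proof (rule Lbar_Inf(2)[OF L])
    fix \<xi> assume "\<xi> \<in> to_Lbar M ` op_bounds M X T"
    then obtain \<eta> where \<eta>: "\<eta> \<in> op_bounds M X T" "\<xi> = to_Lbar M \<eta>" by blast
    have "\<eta> \<in> L0 M" using \<eta>(1) by (auto simp: op_bounds_def intro: L0_posD)
    from rv_rep_class(2)[OF r] bound[OF \<eta>(1)] rv_rep_to_Lbar[OF this]
    show "rv_le M (rv_class M r) \<xi>"
      unfolding rv_le_def \<eta>(2) by eventually_elim (auto simp: r_def field_simps)
  qed simp
  then have "AE w in M. r w \<le> ereal (rv_rep m w)"
    using m(2) rv_rep_class(2)[OF r] rv_rep_to_Lbar[OF m(1)]
    unfolding rv_le_def by eventually_elim simp
  then show ?thesis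
    using bound[OF \<eta>] N_nonneg[OF x]
  proof eventually_elim
    case (elim w)
    then show ?case by (cases "N x w = 0") (auto simp: r_def field_simps)
  qed
qed

section \<open>Neighbourhoods in the topology of convergence in probability\<close>

text \<open>A point \<open>y\<close> of the ball leaves slack both in the distance and in the
  probability, and a small enough ball around \<open>y\<close> uses up no more than that
  slack.\<close>

lemma openin_el_ball:
  assumes x: "x \<in> carrier X" and \<delta>: "0 < \<delta>"
  shows "openin (el_topology M X) {y \<in> carrier X. y \<ominus>\<^bsub>X\<^esub> x \<in> el_nbhd M X \<epsilon> \<delta>}"
    (is "openin _ ?U")
  unfolding openin_el_topology
proof (intro conjI ballI)
  fix y assume y: "y \<in> ?U"
  then have yc: "y \<in> carrier X" and yx: "y \<ominus>\<^bsub>X\<^esub> x \<in> carrier X" using x by auto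
  let ?f = "N (y \<ominus>\<^bsub>X\<^esub> x)"
  \<comment> \<open>Lowering the threshold by \<open>1 / Suc n\<close> exhausts the event from
    below, so by continuity of the measure some \<open>S n\<close> still has probability above
    \<open>\<delta>\<close>.\<close>
  define S where "S n = {w \<in> space M. ?f w < \<epsilon> - 1 / Suc n}" for n :: nat
  note [measurable] = N_measurable[OF yx]
  have S [measurable]: "S n \<in> sets M" for n unfolding S_def by measurable
  have "incseq S"
  proof (intro monoI subsetI)
    fix m n w assume "m \<le> n" and "w \<in> S m"
    moreover from \<open>m \<le> n\<close> have "1 / Suc n \<le> 1 / Suc m" by (simp add: field_simps)
    ultimately show "w \<in> S n" by (auto simp: S_def)
  qed
  moreover have "(\<Union>n. S n) = {w \<in> space M. ?f w < \<epsilon>}"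
  proof (intro Set.set_eqI iffI)
    fix w assume "w \<in> {w \<in> space M. ?f w < \<epsilon>}"
    moreover from this obtain n where "1 / Suc n < \<epsilon> - ?f w"
      using nat_approx_posE[of "\<epsilon> - ?f w"] by auto
    ultimately show "w \<in> (\<Union>n. S n)" by (auto simp: S_def intro!: exI[of _ n])
  next
    fix w assume "w \<in> (\<Union>n. S n)"
    then obtain n where "w \<in> space M" "?f w < \<epsilon> - 1 / Suc n" by (auto simp: S_def)
    moreover have "0 < 1 / real (Suc n)" by simp
    ultimately have "w \<in> space M" "?f w < \<epsilon>" by linarith+
    then show "w \<in> {w \<in> space M. ?f w < \<epsilon>}" by simp
  qed
  ultimately have "(\<lambda>n. prob (S n)) \<longlonglongrightarrow> prob {w \<in> space M. ?f w < \<epsilon>}"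
    using finite_Lim_measure_incseq[of S] by (auto simp: image_subset_iff)
  moreover have "\<delta> < prob {w \<in> space M. ?f w < \<epsilon>}" using y by (simp add: el_nbhd_def)
  ultimately obtain n where n: "\<delta> < prob (S n)"
    by (metis (no_types, lifting) order_tendstoD(1) eventually_sequentially order_refl)
  define \<kappa> where "\<kappa> = (prob (S n) - \<delta>)"
  have \<kappa>: "0 < \<kappa>" "\<kappa> < 1" 
    unfolding \<kappa>_def using n \<delta> prob_le_1[of "S n"] by linarith+
  have "u \<in> ?U" if u: "u \<in> carrier X" and uy: "u \<ominus>\<^bsub>X\<^esub> y \<in> el_nbhd M X (1 / Suc n) (1 - \<kappa>)" for u
  proof -
    have uyc: "u \<ominus>\<^bsub>X\<^esub> y \<in> carrier X" and uxc: "u \<ominus>\<^bsub>X\<^esub> x \<in> carrier X" using u yc x by auto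
    note [measurable] = N_measurable[OF uyc] N_measurable[OF uxc]
    define R where "R = {w \<in> space M. N (u \<ominus>\<^bsub>X\<^esub> y) w < 1 / Suc n}"
    have R [measurable]: "R \<in> sets M" unfolding R_def by measurable
    have "1 - \<kappa> < prob R" using uy by (simp add: el_nbhd_def R_def)
    \<comment> \<open>The union has probability at most 1, so the intersection has at least
      \<open>prob (S n) + prob R - 1\<close>, which exceeds \<open>\<delta>\<close> by the choice of
      \<open>\<kappa>\<close>.\<close>
    have "prob (S n \<union> R) = prob (S n) + prob R - prob (S n \<inter> R)"
      using measure_Un3[of "S n" M R] by (simp add: fmeasurable_eq_sets)
    then have "\<delta> < prob (S n \<inter> R)"
      using prob_le_1[of "S n \<union> R"] \<open>1 - \<kappa> < prob R\<close> by (simp add: \<kappa>_def)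
    also have "\<dots> \<le> prob {w \<in> space M. N (u \<ominus>\<^bsub>X\<^esub> x) w < \<epsilon>}"
      using N_diff_triangle[OF u yc x]
      by (intro finite_measure_mono_AE) (auto simp: S_def R_def elim!: AE_mp)
    finally show ?thesis using u uxc by (simp add: el_nbhd_def)
  qed
  then show "\<exists>\<epsilon>' \<delta>'. 0 < \<epsilon>' \<and> 0 < \<delta>' \<and> \<delta>' < 1 \<and>
      {u \<in> carrier X. u \<ominus>\<^bsub>X\<^esub> y \<in> el_nbhd M X \<epsilon>' \<delta>'} \<subseteq> ?U"
    using \<kappa> by (intro exI[of _ "1 / Suc n"] exI[of _ "1 - \<kappa>"]) auto
qed auto

lemma N_zero: "AE w in M. N \<zero>\<^bsub>X\<^esub> w = 0"
  using N_scale[of "\<zero>\<^bsub>X\<^esub>" "0"] smult_r_null[of "rv_const M 0"]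
  by (simp add: L0_ring_def rv_const_def)

lemma self_mem_el_ball:
  assumes x: "x \<in> carrier X" and "0 < \<epsilon>" "\<delta> < 1"
  shows "x \<ominus>\<^bsub>X\<^esub> x \<in> el_nbhd M X \<epsilon> \<delta>"
proof -
  have [measurable]: "N \<zero>\<^bsub>X\<^esub> \<in> borel_measurable M" by simp
  have "prob {w \<in> space M. N \<zero>\<^bsub>X\<^esub> w < \<epsilon>} = 1"
    using N_zero \<open>0 < \<epsilon>\<close> by (subst prob_Collect_eq_1) (auto elim!: AE_mp)
  then show ?thesis using x assms(3) by (simp add: el_nbhd_def a_minus_def M.r_neg)
qed

text \<open>Balls are open and contain their centre, so a topological limit is a limit in
  probability.\<close>

lemma eventually_el_nbhd_of_limitin:
  assumes "limitin (el_topology M X) f y F" "0 < \<epsilon>" "0 < \<delta>" "\<delta> < 1" "y \<in> carrier X"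
  shows "\<forall>\<^sub>F s in F. f s \<in> carrier X \<and> f s \<ominus>\<^bsub>X\<^esub> y \<in> el_nbhd M X \<epsilon> \<delta>"
  using assms openin_el_ball[of y \<delta> \<epsilon>] self_mem_el_ball[of y \<epsilon> \<delta>]
  unfolding limitin_def by auto

section \<open>Estimates for the C-semigroup\<close>

lemma K_linear_zero:
  assumes "K_linear M X T"
  shows "T \<zero>\<^bsub>X\<^esub> = \<zero>\<^bsub>X\<^esub>"
proof -
  have T: "T \<zero>\<^bsub>X\<^esub> \<in> carrier X" using assms by (auto simp: K_linear_def)
  have "T (\<zero>\<^bsub>X\<^esub> \<oplus>\<^bsub>X\<^esub> \<zero>\<^bsub>X\<^esub>) = T \<zero>\<^bsub>X\<^esub> \<oplus>\<^bsub>X\<^esub> T \<zero>\<^bsub>X\<^esub>"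
    using assms M.zero_closed unfolding K_linear_def by blast
  then have "T \<zero>\<^bsub>X\<^esub> \<oplus>\<^bsub>X\<^esub> T \<zero>\<^bsub>X\<^esub> = T \<zero>\<^bsub>X\<^esub> \<oplus>\<^bsub>X\<^esub> \<zero>\<^bsub>X\<^esub>" using T by simp
  then show ?thesis using T by (simp del: M.r_zero)
qed

lemma K_linear_diff:
  assumes "K_linear M X T" and x: "x \<in> carrier X" and y: "y \<in> carrier X"
  shows "T (x \<ominus>\<^bsub>X\<^esub> y) = T x \<ominus>\<^bsub>X\<^esub> T y"
proof -
  have T: "\<And>x. x \<in> carrier X \<Longrightarrow> T x \<in> carrier X"
    "\<And>x y. x \<in> carrier X \<Longrightarrow> y \<in> carrier X \<Longrightarrow> T (x \<oplus>\<^bsub>X\<^esub> y) = T x \<oplus>\<^bsub>X\<^esub> T y"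
    using assms(1) by (auto simp: K_linear_def)
  have "T (\<ominus>\<^bsub>X\<^esub> y) \<oplus>\<^bsub>X\<^esub> T y = \<zero>\<^bsub>X\<^esub>"
    using T(2)[of "\<ominus>\<^bsub>X\<^esub> y" y] K_linear_zero[OF assms(1)] y by (simp add: M.l_neg)
  then have "\<ominus>\<^bsub>X\<^esub> T y = T (\<ominus>\<^bsub>X\<^esub> y)"
    using T(1) y by (intro M.minus_equality) auto
  then show ?thesis using T(2)[of x "\<ominus>\<^bsub>X\<^esub> y"] x y by (simp add: a_minus_def)
qed

lemma C_semigroup_closed:
  assumes "C_semigroup M X C V" "x \<in> carrier X"
  shows "C x \<in> carrier X" and "0 \<le> s \<Longrightarrow> V s x \<in> carrier X"
  using assms by (fastforce simp: C_semigroup_def bounded_ops_def K_linear_def)+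

lemma diff_quot_closed:
  assumes "C_semigroup M X C V" "x \<in> carrier X" "0 < s"
  shows "diff_quot M X C V s x \<in> carrier X"
  unfolding diff_quot_def using C_semigroup_closed[OF assms(1,2)] assms(3)
  by (intro smult_closed) (simp_all add: L0_ring_def rv_const_def)

text \<open>The telescoping estimate, by induction on \<open>n\<close>: each step adds the increment
  \<open>V (n s) (V s - C) z\<close>, which costs one factor \<open>m\<close> because
  \<open>n s\<close> stays in \<open>[0, l]\<close>.\<close>

lemma N_C_diff_le:
  assumes sg: "C_semigroup M X C V" and z: "z \<in> carrier X" and s: "0 \<le> s"
    and m: "m \<in> L0 M" "\<And>t. \<lbrakk>0 \<le> t; t \<le> l\<rbrakk> \<Longrightarrow> rv_le M (op_norm M X (V t)) (to_Lbar M m)"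
    and l: "real n * s \<le> l"
  shows "AE w in M. N (C (V (real n * s) z \<ominus>\<^bsub>X\<^esub> C z)) w
           \<le> real n * (rv_rep m w * N (V s z \<ominus>\<^bsub>X\<^esub> C z) w)"
  using l
proof (induction n)
  have linC: "K_linear M X C" using sg by (auto simp: C_semigroup_def bounded_ops_def)
  have linV: "K_linear M X (V t)" if "0 \<le> t" for t
    using sg that by (auto simp: C_semigroup_def bounded_ops_def)
  note C = C_semigroup_closed(1)[OF sg]
  note V = C_semigroup_closed(2)[OF sg]
  have V0: "V 0 x = C x" if "x \<in> carrier X" for x
    using sg that by (simp add: C_semigroup_def)
  have CV: "C (V (a + b) x) = V a (V b x)" if "0 \<le> a" "0 \<le> b" "x \<in> carrier X" for a b x
    using sg that by (simp add: C_semigroup_def)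
  {
    case 0
    show ?case
      using N_zero z
      by (auto simp: V0 C K_linear_zero[OF linC] a_minus_def M.r_neg elim: eventually_mono)
  next
    case (Suc n)
    let ?t = "real n * s"
    have t: "0 \<le> ?t" "?t \<le> l" using s Suc.prems by (auto simp: algebra_simps)
    define d where "d = V s z \<ominus>\<^bsub>X\<^esub> C z"
    define e where "e = V ?t z \<ominus>\<^bsub>X\<^esub> C z"
    have d: "d \<in> carrier X" and e: "e \<in> carrier X"
      using z s t by (auto simp: d_def e_def C V)
    \<comment> \<open>The semigroup law with second time 0, where \<open>V 0\<close> is
      \<open>C\<close>, shows that \<open>C\<close> and \<open>V ?t\<close> commute on
      \<open>z\<close>.\<close>
    have "C (V (?t + 0) z) = V ?t (C z)" using CV[OF t(1) order_refl z] V0[OF z] by simp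
    then have "V ?t d = C (V (?t + s) z) \<ominus>\<^bsub>X\<^esub> C (V ?t z)"
      unfolding d_def by (simp add: K_linear_diff[OF linV[OF t(1)]] V C z s CV t)
    \<comment> \<open>Inserting \<open>C (V ?t z)\<close> splits the difference into the new
      increment and the part covered by the induction hypothesis.\<close>
    then have "C (V (real (Suc n) * s) z \<ominus>\<^bsub>X\<^esub> C z) = V ?t d \<oplus>\<^bsub>X\<^esub> C e"
      using z s t diff_add_diff[of "C (V (?t + s) z)" "C (V ?t z)" "C (C z)"]
      by (simp add: e_def K_linear_diff[OF linC] V C algebra_simps)
    moreover have "AE w in M. N (V ?t d) w \<le> rv_rep m w * N d w"
      using sg t m by (intro N_le_of_op_norm_le d) (auto simp: C_semigroup_def)
    moreover have "AE w in M. N (V ?t d \<oplus>\<^bsub>X\<^esub> C e) w \<le> N (V ?t d) w + N (C e) w"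
      by (rule N_triangle) (use V C d e t in auto)
    moreover have "AE w in M. N (C e) w \<le> real n * (rv_rep m w * N d w)"
      unfolding e_def d_def by (rule Suc.IH[OF t(2)])
    ultimately show ?case
      unfolding d_def[symmetric]
    proof (elim AE_mp, intro AE_I2 impI)
      fix w
      assume "N (V ?t d) w \<le> rv_rep m w * N d w"
        and "N (V ?t d \<oplus>\<^bsub>X\<^esub> C e) w \<le> N (V ?t d) w + N (C e) w"
        and "N (C e) w \<le> real n * (rv_rep m w * N d w)"
        and *: "C (V (real (Suc n) * s) z \<ominus>\<^bsub>X\<^esub> C z) = V ?t d \<oplus>\<^bsub>X\<^esub> C e"
      then show "N (C (V (real (Suc n) * s) z \<ominus>\<^bsub>X\<^esub> C z)) w \<le> real (Suc n) * (rv_rep m w * N d w)"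
        unfolding * by (simp add: distrib_right)
    qed
  }
qed

text \<open>With step \<open>s = t / Suc n\<close> the number of increments cancels against the
  scaling, since \<open>Suc n / t = 1 / s\<close>. The quotient at \<open>t\<close> is thus
  controlled by quotients at arbitrarily small times, with a factor independent of
  \<open>n\<close>.\<close>

lemma N_C_diff_quot_le_refine:
  assumes sg: "C_semigroup M X C V" and z: "z \<in> carrier X" and t: "0 < t" "t \<le> l"
    and m: "m \<in> L0 M" "\<And>t. \<lbrakk>0 \<le> t; t \<le> l\<rbrakk> \<Longrightarrow> rv_le M (op_norm M X (V t)) (to_Lbar M m)"
  shows "AE w in M. N (C (diff_quot M X C V t z)) w
           \<le> rv_rep m w * N (diff_quot M X C V (t / real (Suc n)) z) w"
proof -
  define s where "s = t / real (Suc n)"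
  have s: "0 < s" "real (Suc n) * s = t" using t by (simp_all add: s_def)
  have linC: "K_linear M X C" using sg by (auto simp: C_semigroup_def bounded_ops_def)
  note C = C_semigroup_closed(1)[OF sg]
  note V = C_semigroup_closed(2)[OF sg]
  have c: "V r z \<ominus>\<^bsub>X\<^esub> C z \<in> carrier X" if "0 < r" for r using that z by (simp add: V C)
  have norm_inv: "norm (of_real (1 / r) :: 'k) = 1 / r" if "0 < r" for r
    using that by (simp only: norm_of_real) simp
  have "C (diff_quot M X C V t z) = rv_const M (of_real (1 / t)) \<odot>\<^bsub>X\<^esub> C (V t z \<ominus>\<^bsub>X\<^esub> C z)"
    using linC c[OF t(1)] by (simp add: diff_quot_def K_linear_def)
  then have "AE w in M. N (C (diff_quot M X C V t z)) w = 1 / t * N (C (V t z \<ominus>\<^bsub>X\<^esub> C z)) w"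
    using N_scale[OF C[OF c[OF t(1)]], of "of_real (1 / t)"] norm_inv[OF t(1)] by (simp only:)
  moreover have "AE w in M. N (diff_quot M X C V s z) w = 1 / s * N (V s z \<ominus>\<^bsub>X\<^esub> C z) w"
    using N_scale[OF c[OF s(1)], of "of_real (1 / s)"] norm_inv[OF s(1)]
    by (simp only: diff_quot_def)
  moreover have "AE w in M. N (C (V (real (Suc n) * s) z \<ominus>\<^bsub>X\<^esub> C z)) w
      \<le> real (Suc n) * (rv_rep m w * N (V s z \<ominus>\<^bsub>X\<^esub> C z) w)"
    by (rule N_C_diff_le[where l = l, OF sg z less_imp_le[OF s(1)] m(1)])
       (use s(2) t m(2) in simp_all)
  ultimately show ?thesis
    unfolding s_def[symmetric] s(2)
  proof eventually_elim
    case (elim w)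
    have "1 / t * N (C (V t z \<ominus>\<^bsub>X\<^esub> C z)) w
        \<le> 1 / t * (real (Suc n) * (rv_rep m w * N (V s z \<ominus>\<^bsub>X\<^esub> C z) w))"
      using elim(3) t(1) by (intro mult_left_mono) auto
    also have "\<dots> = rv_rep m w * (1 / s * N (V s z \<ominus>\<^bsub>X\<^esub> C z) w)"
      using t by (simp add: s_def)
    finally show ?case using elim by simp
  qed
qed

text \<open>The limit of the refined estimates as the step tends to 0. Convergence is only in
  probability, so the inequality is first proved with an error \<open>\<epsilon>\<close> on events
  of probability close to 1, without extracting an almost surely convergent subsequence.\<close>

lemma N_C_diff_quot_le:
  assumes sg: "C_semigroup M X C V" and z: "z \<in> carrier X" and t: "0 < t" "t \<le> l"
    and m: "m \<in> L0_pos M" "\<And>t. \<lbrakk>0 \<le> t; t \<le> l\<rbrakk> \<Longrightarrow> rv_le M (op_norm M X (V t)) (to_Lbar M m)"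
    and y: "y \<in> carrier X"
      "limitin (el_topology M X) (\<lambda>s. diff_quot M X C V s z) y (at_right 0)"
  shows "AE w in M. N (C (diff_quot M X C V t z)) w \<le> rv_rep m w * N y w"
proof -
  note mL = L0_posD(1)[OF m(1)]
  let ?q = "\<lambda>s. diff_quot M X C V s z"
  let ?g = "N (C (?q t))"
  note C = C_semigroup_closed(1)[OF sg]
  note q = diff_quot_closed[OF sg z]
  note [measurable] = N_measurable[OF C[OF q[OF t(1)]]] N_measurable[OF y(1)] rv_rep_measurable[OF mL]
  have to0: "filterlim (\<lambda>n. t / real (Suc n)) (at_right 0) sequentially"
    using t by real_asymp
  have main: "AE w in M. ?g w \<le> rv_rep m w * (\<epsilon> + N y w)" if \<epsilon>: "0 < \<epsilon>" for \<epsilon>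
  proof -
    \<comment> \<open>This event does not mention the step size, so for each \<open>\<delta>\<close>
      one sufficiently large \<open>n\<close> suffices to bound its probability from below.\<close>
    let ?E = "{w \<in> space M. ?g w \<le> rv_rep m w * (\<epsilon> + N y w)}"
    have "\<delta> < prob ?E" if \<delta>: "0 < \<delta>" "\<delta> < 1" for \<delta>
    proof -
      have "\<forall>\<^sub>F n in sequentially. ?q (t / real (Suc n)) \<ominus>\<^bsub>X\<^esub> y \<in> el_nbhd M X \<epsilon> \<delta>"
        using eventually_el_nbhd_of_limitin[OF y(2) \<epsilon> \<delta> y(1)] to0
        by (auto simp: filterlim_iff elim: eventually_mono)
      then obtain n where n: "?q (t / real (Suc n)) \<ominus>\<^bsub>X\<^esub> y \<in> el_nbhd M X \<epsilon> \<delta>"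
        by (auto simp: eventually_sequentially)
      define x where "x = ?q (t / real (Suc n))"
      have x: "x \<in> carrier X" using q t by (simp add: x_def)
      have "x = (x \<ominus>\<^bsub>X\<^esub> y) \<oplus>\<^bsub>X\<^esub> y"
        using x y(1) by (simp add: a_minus_def M.a_assoc M.l_neg)
      then have tri: "AE w in M. N x w \<le> N (x \<ominus>\<^bsub>X\<^esub> y) w + N y w"
        using N_triangle[of "x \<ominus>\<^bsub>X\<^esub> y" y] x y(1) by simp
      have "\<delta> < prob {w \<in> space M. N (x \<ominus>\<^bsub>X\<^esub> y) w < \<epsilon>}"
        using n by (simp add: el_nbhd_def x_def)
      also have "\<dots> \<le> prob ?E"
      proof (rule finite_measure_mono_AE)
        show "AE w in M. w \<in> {w \<in> space M. N (x \<ominus>\<^bsub>X\<^esub> y) w < \<epsilon>} \<longrightarrow> w \<in> ?E"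
          using tri L0_posD(2)[OF m(1)]
            N_C_diff_quot_le_refine[OF sg z t mL m(2), of n, folded x_def, simplified] AE_space
        proof eventually_elim
          case (elim w)
          have "rv_rep m w * N x w \<le> rv_rep m w * (\<epsilon> + N y w)"
            if "N (x \<ominus>\<^bsub>X\<^esub> y) w < \<epsilon>"
            using elim that by (intro mult_left_mono) auto
          then show ?case using elim by auto
        qed
      qed measurable
      finally show ?thesis .
    qed
    \<comment> \<open>The probability exceeds every \<open>\<delta>\<close> in
      \<open>(0, 1)\<close>, hence is 1.\<close>
    then have "1 \<le> prob ?E" by (intro dense_le_bounded[of 0 1]) (auto intro: less_imp_le)
    then have "prob ?E = 1" using prob_le_1[of ?E] by linarith
    then show ?thesis by (subst (asm) prob_Collect_eq_1) auto
  qed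
  \<comment> \<open>Restricting the error to the values \<open>1 / Suc k\<close> leaves countably
    many null sets; off their union the error tends to 0 pointwise.\<close>
  then have "AE w in M. \<forall>k. ?g w \<le> rv_rep m w * (1 / real (Suc k) + N y w)"
    unfolding AE_all_countable by simp
  then show ?thesis
  proof eventually_elim
    case (elim w)
    have "(\<lambda>k. rv_rep m w * (1 / real (Suc k) + N y w)) \<longlonglongrightarrow> rv_rep m w * (0 + N y w)"
      by (intro tendsto_intros LIMSEQ_Suc lim_1_over_n)
    then have "?g w \<le> rv_rep m w * (0 + N y w)"
      by (rule LIMSEQ_le_const) (use elim in auto)
    then show ?case by simp
  qed
qed

end

section \<open>The supremum over all times in \<open>(0, l]\<close>\<close>

theorem lemma4p1:
  fixes M :: "'a measure"
    and X :: "('a, 'k::{real_normed_field,euclidean_space}, 'x) rn_struct"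
    and C A :: "'x \<Rightarrow> 'x" and V :: "real \<Rightarrow> 'x \<Rightarrow> 'x" and D :: "'x set"
    and l :: real and z :: 'x
  assumes "rn_module M X"
    and "rn_complete M X"
    and "C \<in> bounded_ops M X" and "inj_on C (carrier X)"
    and "C_semigroup M X C V"
    and "locally_as_bounded M X V"
    and "is_generator M X C V A D"
    and "l > 0" and "z \<in> D"
  shows "\<Squnion>\<^bsub>Lbar M\<^esub> ((\<lambda>s. to_Lbar M (l0norm X (C (diff_quot M X C V s z)))) ` {0<..l})
           \<in> to_Lbar M ` L0_pos M"
proof -
  interpret rn_module M X by fact
  \<comment> \<open>The limit \<open>y\<close> stands for \<open>C (A z)\<close>; lying in the range
    of \<open>C\<close>, it belongs to the carrier.\<close>
  obtain y where z: "z \<in> carrier X" and y: "y \<in> C ` carrier X"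
    "limitin (el_topology M X) (\<lambda>s. diff_quot M X C V s z) y (at_right 0)"
    using assms(7,9) by (auto simp: is_generator_def)
  note C = C_semigroup_closed(1)[OF assms(5)]
  note q = diff_quot_closed[OF assms(5) z]
  have yc: "y \<in> carrier X" using y(1) C by auto
  obtain m where m: "m \<in> L0_pos M"
    "\<Squnion>\<^bsub>Lbar M\<^esub> ((\<lambda>s. op_norm M X (V s)) ` {0..l}) = to_Lbar M m"
    using assms(6,8) by (auto simp: locally_as_bounded_def)
  have op: "op_norm M X T \<in> L0 M" for T
    unfolding op_norm_def
    by (rule Lbar_Inf) (auto simp: op_bounds_def intro!: to_Lbar_in_L0 L0_posD)
  have le: "rv_le M (op_norm M X (V s)) (to_Lbar M m)" if "0 \<le> s" "s \<le> l" for s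
    unfolding m(2)[symmetric] by (rule Lbar_Sup(2)) (use op that in auto)
  \<comment> \<open>A single real random variable that dominates all the norms: neither
    \<open>m\<close> nor \<open>y\<close> depends on the time \<open>s\<close>.\<close>
  define \<eta> where "\<eta> = rv_class M (\<lambda>w. rv_rep m w * N y w)"
  have p [measurable]: "(\<lambda>w. rv_rep m w * N y w) \<in> borel_measurable M"
    by (intro borel_measurable_times rv_rep_measurable L0_posD m N_measurable yc)
  have \<eta>: "\<eta> \<in> L0 M" by (simp add: \<eta>_def)
  show ?thesis
  proof (rule Lbar_Sup_in_L0_pos[OF _ _ \<eta>])
    fix \<xi> assume "\<xi> \<in> (\<lambda>s. to_Lbar M (l0norm X (C (diff_quot M X C V s z)))) ` {0<..l}"
    then obtain s where s: "0 < s" "s \<le> l"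
      and \<xi>: "\<xi> = to_Lbar M (l0norm X (C (diff_quot M X C V s z)))" by auto
    have "AE w in M. N (C (diff_quot M X C V s z)) w \<le> rv_rep m w * N y w"
      by (rule N_C_diff_quot_le[OF assms(5) z s m(1) le yc y(2)])
    then show "rv_le M \<xi> (to_Lbar M \<eta>)"
      using rv_rep_to_Lbar[OF \<eta>] rv_rep_to_Lbar[OF l0norm_in_L0[OF C[OF q[OF s(1)]]]]
        rv_rep_class(2)[OF p]
      unfolding rv_le_def \<xi> \<eta>_def[symmetric] by eventually_elim simp
  \<comment> \<open>Positivity of \<open>l\<close> makes the index interval nonempty, as the
    finiteness criterion requires.\<close>
  qed (use assms(8) C q l0norm_pos in auto)
qed

end
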